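(* Let $Y\sim G$ be a random variable with values in $\mathbb{R}_+=[0,\infty)$ having finite moments of all positive integer orders, and let $G$ be absolutely continuous on $\mathbb{R}_{+,x_0}=[x_0,\infty)$ for some $x_0>1$ with density $G'(x)=g(x)>0$ on $\mathbb{R}_{+,x_0}$. Let $a>0$ and $\alpha\in[0,1]$, and assume that $$\limsup_{x\to\infty}\frac{g(x+a(\log x)^{\alpha})}{g(x)}<1.$$ Then $Y$ and $Y^2$ each satisfy Carleman's condition $({\rm C_S})$, i.e. $$\sum_{n=1}^{\infty}\left(\mathsf{E}[Y^{n}]\right)^{-1/(2n)}=\infty\quad\text{and}\quad \sum_{n=1}^{\infty}\left(\mathsf{E}[Y^{2n}]\right)^{-1/(2n)}=\infty;$$ hence they both are M-det on $\mathbb{R}_+$.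
   Context: $Y\sim G$ means that the random variable $Y$ has distribution (function) $G$. The distribution $G$ is arbitrary on $[0,x_0)$; only its restriction to $[x_0,\infty)$ is assumed absolutely continuous. Carleman's condition $({\rm C_S})$ for a random variable $W$ with values in $\mathbb{R}_+$ and finite moments: $\sum_{n=1}^{\infty}(\mathsf{E}[W^n])^{-1/(2n)}=\infty$. M-determinacy: a random variable with values in $\mathbb{R}_+$ and finite moments of all orders is M-det (moment-determinate) on $\mathbb{R}_+$ if no probability distribution on $\mathbb{R}_+$ other than its own has the same moment sequence (moments of all orders $n\in\mathbb{N}=\{1,2,\ldots\}$). *)

theory Defs
  imports "HOL-Probability.Probability"
begin

text \<open>
  The distribution function \<open>G\<close> is absolutely continuous on \<open>[b, \<infinity>)\<close> with density \<open>g\<close>.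
  Nothing is required of \<open>g\<close> to the left of \<open>b\<close>.
\<close>

definition absolutely_continuous_with_density_from ::
    "(real \<Rightarrow> real) \<Rightarrow> real \<Rightarrow> (real \<Rightarrow> real) \<Rightarrow> bool" where
  "absolutely_continuous_with_density_from G b g \<longleftrightarrow>
     (\<forall>x\<ge>b. set_integrable lborel {b..x} g \<and> G x - G b = (LBINT t:{b..x}. g t))"

definition nonneg_with_finite_moments :: "'a measure \<Rightarrow> ('a \<Rightarrow> real) \<Rightarrow> bool" where
  "nonneg_with_finite_moments M W \<longleftrightarrow>
     W \<in> borel_measurable M \<and> (AE \<omega> in M. 0 \<le> W \<omega>) \<and>
     (\<forall>n\<ge>1. integrable M (\<lambda>\<omega>. W \<omega> ^ n))"

text \<open>
  The index of the series is shifted, so that it starts at \<open>n = 1\<close>.  The negative power is an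
  inverse in the extended nonnegative reals, so that a zero moment contributes \<open>\<infinity>\<close>
  (for reals, \<open>0 powr r = 0\<close>).
\<close>

definition carleman_S :: "'a measure \<Rightarrow> ('a \<Rightarrow> real) \<Rightarrow> bool" where
  "carleman_S M W \<longleftrightarrow>
     nonneg_with_finite_moments M W \<and>
     (\<Sum>n. inverse (ennreal ((\<integral>\<omega>. W \<omega> ^ Suc n \<partial>M) powr (1 / (2 * real (Suc n)))))) = \<infinity>"

definition M_det_nonneg :: "'a measure \<Rightarrow> ('a \<Rightarrow> real) \<Rightarrow> bool" where
  "M_det_nonneg M W \<longleftrightarrow>
     nonneg_with_finite_moments M W \<and>
     (\<forall>N. real_distribution N \<and> nonneg_with_finite_moments N (\<lambda>x. x) \<and>
          (\<forall>n\<ge>1. (\<integral>x. x ^ n \<partial>N) = (\<integral>\<omega>. W \<omega> ^ n \<partial>M))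
        \<longrightarrow> N = distr M borel W)"

end

theory Submission
  imports Defs "HOL-Real_Asymp.Real_Asymp"
begin

text \<open>
  \<^bold>\<open>Growth of the moments.\<close>  Put \<open>T x = x + a (ln x)\<^sup>\<alpha>\<close>.  The hypothesis says that
  \<open>g (T x) \<le> q g x\<close> for some \<open>q < 1\<close> and all large \<open>x\<close>.  Substituting \<open>T\<close> compares the integral of
  \<open>x\<^sup>n g x\<close> over \<open>[T R, \<infinity>)\<close> with the integral over \<open>[R, \<infinity>)\<close>: the integrand is multiplied by
  \<open>(T x / x)\<^sup>n \<cdot> g (T x) / g x \<cdot> T' x\<close>.  Here \<open>T' x\<close> tends to \<open>1\<close>, and \<open>(T x / x)\<^sup>n \<le> exp (n a ln x / x)\<close> is
  close to \<open>1\<close> on \<open>[R, \<infinity>)\<close> once \<open>R = K n ln n\<close> with \<open>K\<close> large.  The factor is then at most a constant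
  \<open>\<theta> < 1\<close>, so the tail beyond \<open>T R\<close> is at most a fixed fraction of the tail beyond \<open>R\<close>, and the whole tail is
  controlled by the integral over \<open>[R, T R]\<close>, hence by \<open>(T R)\<^sup>n \<le> (2 R)\<^sup>n\<close>.  So the moment of order \<open>n \<ge> 3\<close>
  is at most \<open>(C n ln n)\<^sup>n\<close> (\<open>moment_growth\<close>), and Carleman's condition for both \<open>Y\<close> and \<open>Y\<^sup>2\<close>
  follows from the divergence of the sum of \<open>1 / (n ln n)\<close> (\<open>carleman_S_of_growth\<close>).

  \<^bold>\<open>Determinacy.\<close>  That Carleman's condition implies determinacy on the half-line
  (\<open>carleman_S_imp_M_det\<close>) is reduced to the real line by passing from a law on the half-line to the
  law of the square root with a random sign, whose even moments are the moments of the given law and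
  whose odd moments vanish.  For two laws on the line with the same moments, the difference of the
  characteristic functions has all its derivatives equal to \<open>0\<close> at the origin, and the \<open>j\<close>-th
  derivative is bounded by twice the absolute moment of order \<open>j\<close>.  Carleman's condition on the
  moments implies, through Carleman's inequality for geometric means (\<open>summable_geometric_means\<close>),
  that the ratios of consecutive bounds have a divergent sum of reciprocals.  The Denjoy--Carleman
  theorem (\<open>quasianalytic_vanishing\<close>) then makes the difference vanish identically, and the two laws
  agree because they have the same characteristic function.
\<close>

section \<open>Carleman's inequality for geometric means\<close>

text \<open>
  Polya's proof.  The weights \<open>c k\<close> are chosen so that \<open>c 0 \<cdots> c (n - 1) = (n + 1)\<^sup>n\<close>.  The
  inequality between the means, applied to \<open>a k \<cdot> c k\<close>, then bounds the geometric mean of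
  \<open>a 0, \<dots>, a n\<close> by the sum of the \<open>a k \<cdot> c k\<close> divided by \<open>(n + 1) (n + 2)\<close>.  Summation over \<open>n\<close>
  telescopes and leaves \<open>c k / (k + 1)\<close>, which is at most \<open>e\<close>, as the coefficient of \<open>a k\<close>.
\<close>
lemma carleman_inequality_partial:
  fixes a :: "nat \<Rightarrow> real"
  assumes a: "\<And>n. 0 \<le> a n"
  shows "(\<Sum>n<P. (\<Prod>k<Suc n. a k) powr (1 / real (Suc n))) \<le> exp 1 * (\<Sum>k<P. a k)"
proof -
  define c where "c k = (real k + 2) ^ Suc k / (real k + 1) ^ k" for k
  define S where "S n = (\<Sum>k<n. a k * c k)" for n
  have c_nonneg: "0 \<le> c k" for k
    by (simp add: c_def)
  have prod_c: "(\<Prod>k<n. c k) = (real n + 1) ^ n" for n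
    by (induction n) (simp_all add: c_def field_simps)
  have mean_le: "(\<Prod>k<Suc n. a k) powr (1 / real (Suc n)) \<le> S (Suc n) / ((real n + 1) * (real n + 2))" for n
  proof -
    have "(\<Prod>k<Suc n. a k) powr (1 / real (Suc n)) * (real n + 2)
        = (\<Prod>k<Suc n. a k) powr (1 / real (Suc n)) * (\<Prod>k<Suc n. c k) powr (1 / real (Suc n))"
      unfolding prod_c
      by (subst powr_realpow [symmetric]) (simp_all add: powr_powr del: powr_realpow)
    also have "\<dots> = (\<Prod>k<Suc n. a k * c k) powr (1 / real (Suc n))"
      by (simp add: prod.distrib powr_mult prod_nonneg a c_nonneg del: prod.lessThan_Suc)
    also have "\<dots> \<le> (\<Sum>k<Suc n. a k * c k / real (Suc n))"
      using arith_geom_mean [of "{..<Suc n}" "\<lambda>k. a k * c k"]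
      by (simp add: a c_nonneg lessThan_empty_iff del: prod.lessThan_Suc sum.lessThan_Suc)
    also have "\<dots> = S (Suc n) / (real n + 1)"
      by (simp add: S_def sum_divide_distrib [symmetric] add.commute del: sum.lessThan_Suc)
    finally have "(\<Prod>k<Suc n. a k) powr (1 / real (Suc n)) \<le> S (Suc n) / (real n + 1) / (real n + 2)"
      by (rule mult_imp_le_div_pos [rotated]) simp
    thus ?thesis
      by (simp only: divide_divide_eq_left)
  qed
  \<comment> \<open>The extra summand is the tail of the telescoping series, which makes the induction work.\<close>
  have "(\<Sum>n<P. (\<Prod>k<Suc n. a k) powr (1 / real (Suc n))) + S P / (real P + 1)
      \<le> (\<Sum>k<P. a k * c k / (real k + 1))"
  proof (induction P)
    case 0
    show ?case by (simp add: S_def)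
  next
    case (Suc P)
    have "S (Suc P) / ((real P + 1) * (real P + 2)) + S (Suc P) / (real P + 2) = S (Suc P) / (real P + 1)"
      by (simp add: divide_simps) (simp add: algebra_simps)
    also have "\<dots> = S P / (real P + 1) + a P * c P / (real P + 1)"
      by (simp add: S_def add_divide_distrib)
    finally show ?case
      using Suc.IH mean_le [of P] by (simp add: add.commute)
  qed
  moreover have "0 \<le> S P / (real P + 1)"
    by (simp add: S_def sum_nonneg a c_nonneg)
  moreover have "a k * c k / (real k + 1) \<le> exp 1 * a k" for k
  proof -
    have "c k / (real k + 1) = (1 + 1 / (real k + 1)) ^ Suc k"
      by (simp add: c_def field_simps power_divide)
    also have "\<dots> \<le> exp (1 / (real k + 1)) ^ Suc k"
      by (intro power_mono) (simp_all add: exp_ge_add_one_self)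
    also have "\<dots> = exp 1"
      by (simp add: exp_of_nat_mult [symmetric] add.commute del: power_Suc)
    finally have "a k * (c k / (real k + 1)) \<le> a k * exp 1"
      by (rule mult_left_mono) (rule a)
    thus ?thesis
      by (simp add: mult.commute)
  qed
  hence "(\<Sum>k<P. a k * c k / (real k + 1)) \<le> exp 1 * (\<Sum>k<P. a k)"
    unfolding sum_distrib_left by (intro sum_mono) auto
  ultimately show ?thesis
    by linarith
qed

lemma summable_geometric_means:
  fixes a :: "nat \<Rightarrow> real"
  assumes a: "\<And>n. 0 \<le> a n" and "summable a"
  shows "summable (\<lambda>n. (\<Prod>k<Suc n. a k) powr (1 / real (Suc n)))"
proof (rule summableI_nonneg_bounded)
  fix P
  have "exp 1 * (\<Sum>k<P. a k) \<le> exp 1 * suminf a"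
    using assms by (intro mult_left_mono sum_le_suminf) auto
  with carleman_inequality_partial [of a P, OF a]
  show "(\<Sum>n<P. (\<Prod>k<Suc n. a k) powr (1 / real (Suc n))) \<le> exp 1 * suminf a"
    by (rule order_trans)
qed simp

section \<open>The Denjoy--Carleman uniqueness theorem\<close>

text \<open>
  The functions \<open>D j\<close> play the role of the successive derivatives of \<open>D 0\<close>; only the Taylor estimate
  between them is used.  The step is due to Bang.  Suppose that at \<open>s\<close> the functions obey
  their a priori bounds \<open>B j\<close> improved by the factors \<open>exp (j - (K + 1))\<close>.  For \<open>j > K\<close> the assertion at \<open>t\<close> is
  implied by the a priori bound.  For \<open>j \<le> K\<close> the Taylor polynomial up to order \<open>K + 1\<close> is taken:
  the remainder obeys the same bound as the other terms because the factor \<open>exp (j - (K + 1))\<close> is \<open>1\<close>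
  in order \<open>K + 1\<close>, and the \<open>i\<close>-th term carries \<open>(\<bar>t - s\<bar> e r\<^sub>K)\<^sup>i / i! \<le> 1 / i!\<close>.  The sum loses
  at most a factor \<open>e\<close>.
\<close>
lemma quasianalytic_step:
  fixes D :: "nat \<Rightarrow> real \<Rightarrow> complex" and r :: "nat \<Rightarrow> real" and c :: real
  defines "B \<equiv> \<lambda>j. c * (\<Prod>k<j. r k)"
  assumes r_pos: "\<And>n. 0 < r n" and "incseq r"
    and bound: "\<And>j. norm (D j t) \<le> B j"
    and taylor: "\<And>j n. norm (D j t - (\<Sum>i<n. of_real ((t - s) ^ i / fact i) * D (i + j) s))
                    \<le> \<bar>t - s\<bar> ^ n / fact n * B (n + j)"
    and small: "\<And>j. norm (D j s) \<le> exp (real j - real (Suc K)) * B j"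
    and close: "\<bar>t - s\<bar> \<le> 1 / (exp 1 * r K)"
  shows "norm (D j t) \<le> exp (real j - real K) * B j"
proof -
  have B_nonneg: "0 \<le> B i" for i
    using bound [of i] norm_ge_zero order_trans by blast
  show ?thesis
  proof (cases "j \<le> K")
    case False
    hence "1 * B j \<le> exp (real j - real K) * B j"
      by (intro mult_right_mono B_nonneg) simp
    with bound [of j] show ?thesis by simp
  next
    case True
    define N where "N = Suc K"
    define n where "n = N - j"
    have n: "n + j = N"
      using True by (simp add: n_def N_def)
    define h where "h = \<bar>t - s\<bar>"
    have growth: "B (i + j) \<le> r K ^ i * B j" if "i + j \<le> N" for i
      using that
    proof (induction i)
      case (Suc i)
      have "B (Suc i + j) = r (i + j) * B (i + j)"
        by (simp add: B_def)
      also have "\<dots> \<le> r K * (r K ^ i * B j)"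
        using Suc \<open>incseq r\<close> r_pos B_nonneg
        by (intro mult_mono) (auto simp: N_def incseq_def less_imp_le)
      finally show ?case by (simp add: mult_ac)
    qed simp
    have "norm (D j t) \<le> norm (\<Sum>i<n. of_real (((t - s)) ^ i / fact i) * D (i + j) s) + h ^ n / fact n * B N"
      using taylor [of j n] norm_triangle_ineq2 [of "D j t" "\<Sum>i<n. of_real ((t - s) ^ i / fact i) * D (i + j) s"]
      unfolding n h_def by linarith
    also have "norm (\<Sum>i<n. of_real ((t - s) ^ i / fact i) * D (i + j) s)
        \<le> (\<Sum>i<n. h ^ i / fact i * (exp (real (i + j) - real N) * B (i + j)))"
      using small unfolding N_def [symmetric]
      by (intro sum_norm_le)
         (simp add: norm_mult power_abs h_def divide_right_mono mult_left_mono
            del: of_nat_add of_real_diff of_real_divide of_real_power)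
    also have "\<dots> + h ^ n / fact n * B N
        = (\<Sum>i<Suc n. h ^ i / fact i * (exp (real (i + j) - real N) * B (i + j)))"
      using n by simp
    also have "\<dots> \<le> (\<Sum>i<Suc n. 1 / fact i * (exp (real j - real N) * B j))"
    proof (rule sum_mono)
      fix i assume "i \<in> {..<Suc n}"
      hence i: "i + j \<le> N" using n by simp
      have "h ^ i * (exp (real (i + j) - real N) * B (i + j))
          \<le> h ^ i * (exp (real (i + j) - real N) * (r K ^ i * B j))"
        using growth [OF i] by (intro mult_left_mono) (auto simp: h_def)
      also have "\<dots> = (h * (exp 1 * r K)) ^ i * (exp (real j - real N) * B j)"
        by (simp add: exp_diff exp_add power_mult_distrib exp_of_nat_mult [symmetric] field_simps)
      also have "\<dots> \<le> 1 ^ i * (exp (real j - real N) * B j)"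
        using close r_pos [of K] B_nonneg
        by (intro mult_right_mono power_mono) (auto simp: h_def field_simps)
      finally show "h ^ i / fact i * (exp (real (i + j) - real N) * B (i + j))
          \<le> 1 / fact i * (exp (real j - real N) * B j)"
        by (simp add: divide_simps)
    qed
    also have "\<dots> = (\<Sum>i<Suc n. 1 / fact i) * (exp (real j - real N) * B j)"
      by (simp only: sum_distrib_right)
    also have "\<dots> \<le> exp 1 * (exp (real j - real N) * B j)"
    proof (rule mult_right_mono)
      show "(\<Sum>i<Suc n. 1 / fact i) \<le> exp (1::real)"
        using sum_le_suminf [OF summable_exp [of "1::real"], of "{..<Suc n}"]
        by (simp add: exp_def scaleR_conv_of_real inverse_eq_divide)
    qed (simp add: B_nonneg)
    also have "\<dots> = exp (real j - real K) * B j"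
      by (simp add: N_def exp_diff exp_add)
    finally show ?thesis
      by simp
  qed
qed

text \<open>
  The uniqueness half of the Denjoy--Carleman theorem.  At the origin the smallness required by the
  preceding step holds for every index \<open>K + d\<close>.  Each step lowers the index by one and moves by
  \<open>w k = 1 / (e r\<^sub>k)\<close>; since the sum of the \<open>w k\<close> diverges, every point is reached with
  any prescribed index \<open>K\<close>, and \<open>K\<close> can then tend to infinity.
\<close>
theorem quasianalytic_vanishing:
  fixes D :: "nat \<Rightarrow> real \<Rightarrow> complex" and r :: "nat \<Rightarrow> real" and c :: real
  defines "B \<equiv> \<lambda>j. c * (\<Prod>k<j. r k)"
  assumes r_pos: "\<And>n. 0 < r n" and "incseq r"
    and bound: "\<And>j t. norm (D j t) \<le> B j"
    and taylor: "\<And>j n s t. norm (D j t - (\<Sum>i<n. of_real ((t - s) ^ i / fact i) * D (i + j) s))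
                    \<le> \<bar>t - s\<bar> ^ n / fact n * B (n + j)"
    and zero: "\<And>j. D j 0 = 0"
    and diverges: "\<not> summable (\<lambda>n. 1 / r n)"
  shows "D j t = 0"
proof -
  define w where "w k = 1 / (exp 1 * r k)" for k
  have w_pos: "0 < w k" for k
    by (simp add: w_def r_pos)
  have B_nonneg: "0 \<le> B i" for i
    using bound [of i] norm_ge_zero order_trans by blast
  have reach: "norm (D j t) \<le> exp (real j - real K) * B j"
    if "\<bar>t\<bar> \<le> (\<Sum>k=K..<K+d. w k)" for d K t j
    using that
  proof (induction d arbitrary: K t j)
    case 0
    thus ?case by (simp add: zero B_nonneg)
  next
    case (Suc d)
    define S where "S = (\<Sum>k=Suc K..<Suc K + d. w k)"
    have S: "0 \<le> S" "\<bar>t\<bar> \<le> w K + S"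
      using Suc.prems sum.atLeast_Suc_lessThan [of K "K + Suc d" w]
      by (simp_all add: S_def sum_nonneg less_imp_le w_pos)
    \<comment> \<open>The segment from \<open>0\<close> to \<open>t\<close> is divided in the ratio \<open>S : w K\<close>: the induction hypothesis covers
        the part up to \<open>s\<close>, a single step the rest.\<close>
    define s where "s = t * (S / (w K + S))"
    have pos: "0 < w K + S"
      using w_pos [of K] S by linarith
    have s_le: "\<bar>s\<bar> \<le> S"
      using S pos mult_left_mono [of "\<bar>t\<bar>" "w K + S" S] by (simp add: s_def abs_mult field_simps)
    have "t - s = t * (w K / (w K + S))"
      using pos by (simp add: s_def field_simps)
    hence "\<bar>t - s\<bar> = \<bar>t\<bar> * (w K / (w K + S))"
      using pos w_pos [of K] by (simp add: abs_mult)
    also have "\<dots> \<le> (w K + S) * (w K / (w K + S))"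
      using S pos w_pos [of K] by (intro mult_right_mono) auto
    finally have "\<bar>t - s\<bar> \<le> w K"
      using pos by simp
    moreover have "norm (D i s) \<le> exp (real i - real (Suc K)) * B i" for i
      by (rule Suc.IH) (use s_le in \<open>simp add: S_def\<close>)
    ultimately show ?case
      unfolding B_def w_def
      by (rule quasianalytic_step [OF r_pos \<open>incseq r\<close> bound [unfolded B_def] taylor [unfolded B_def], rotated])
  qed
  have le: "norm (D j t) \<le> exp (real j - real K) * B j" for K
  proof -
    have "\<not> summable (\<lambda>k. w (k + K))"
    proof
      assume "summable (\<lambda>k. w (k + K))"
      hence "summable w" by (rule summable_iff_shift [THEN iffD1])
      hence "summable (\<lambda>k. exp 1 * w k)" by (rule summable_mult)
      with diverges show False by (simp add: w_def)
    qed
    then obtain d where "\<bar>t\<bar> \<le> (\<Sum>k<d. w (k + K))"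
      using w_pos by (meson less_imp_le linorder_linear summableI_nonneg_bounded)
    also have "\<dots> = (\<Sum>k=K..<K+d. w k)"
      using sum.shift_bounds_nat_ivl [of w 0 K d] by (simp add: atLeast0LessThan add.commute)
    finally show ?thesis
      by (rule reach)
  qed
  have "(\<lambda>K. exp (real j - real K) * B j) \<longlonglongrightarrow> 0 * B j"
    by (intro tendsto_mult tendsto_const) real_asymp
  hence "norm (D j t) \<le> 0 * B j"
    by (rule LIMSEQ_le_const) (use le in auto)
  thus ?thesis by simp
qed

section \<open>Carleman's criterion on the real line\<close>

text \<open>
  The integral of \<open>\<bar>f\<bar>\<^sup>n (l - \<bar>f\<bar>)\<^sup>2\<close> is a nonnegative quadratic polynomial in \<open>l\<close>; the
  assertion is that its discriminant is not positive.
\<close>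
lemma moments_log_convex:
  fixes f :: "'a \<Rightarrow> real"
  assumes int: "\<And>n. integrable M (\<lambda>x. \<bar>f x\<bar> ^ n)"
  shows "(\<integral>x. \<bar>f x\<bar> ^ Suc n \<partial>M)\<^sup>2 \<le> (\<integral>x. \<bar>f x\<bar> ^ n \<partial>M) * (\<integral>x. \<bar>f x\<bar> ^ Suc (Suc n) \<partial>M)"
proof -
  define A where "A = (\<integral>x. \<bar>f x\<bar> ^ n \<partial>M)"
  define B where "B = (\<integral>x. \<bar>f x\<bar> ^ Suc n \<partial>M)"
  define C where "C = (\<integral>x. \<bar>f x\<bar> ^ Suc (Suc n) \<partial>M)"
  have quad: "0 \<le> l\<^sup>2 * A - 2 * l * B + C" for l
  proof -
    have "0 \<le> (\<integral>x. \<bar>f x\<bar> ^ n * (l - \<bar>f x\<bar>)\<^sup>2 \<partial>M)"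
      by (intro integral_nonneg_AE) simp
    also have "\<dots> = (\<integral>x. l\<^sup>2 * \<bar>f x\<bar> ^ n - 2 * l * \<bar>f x\<bar> ^ Suc n + \<bar>f x\<bar> ^ Suc (Suc n) \<partial>M)"
      by (intro Bochner_Integration.integral_cong) (simp_all add: power2_eq_square algebra_simps)
    also have "\<dots> = l\<^sup>2 * A - 2 * l * B + C"
      unfolding A_def B_def C_def
      by (subst Bochner_Integration.integral_add Bochner_Integration.integral_diff; (intro integrable_mult_right int Bochner_Integration.integrable_diff)?)+
         (simp del: power_Suc)
    finally show ?thesis .
  qed
  have "0 \<le> A"
    unfolding A_def by (intro integral_nonneg_AE) simp
  show ?thesis
  proof (cases "A = 0")
    case True
    have "B = 0"
    proof (rule ccontr)
      assume "B \<noteq> 0"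
      with quad [of "(C + 1) / (2 * B)"] True show False by simp
    qed
    with True show ?thesis by (simp add: A_def B_def)
  next
    case False
    with \<open>0 \<le> A\<close> have "0 < A" by simp
    with quad [of "B / A"] have "B\<^sup>2 \<le> A * C"
      by (simp add: power2_eq_square field_simps)
    thus ?thesis by (simp add: A_def B_def C_def)
  qed
qed

lemma iexp_taylor_remainder:
  "norm (iexp x - (\<Sum>k<n. (\<i> * x) ^ k / fact k)) \<le> \<bar>x\<bar> ^ n / fact n"
proof (cases n)
  case (Suc m)
  thus ?thesis using iexp_approx1 [of x m] by (simp only: lessThan_Suc_atMost)
qed simp

text \<open>
  The \<open>j\<close>-th derivative of the characteristic function, represented by the integral that
  differentiation under the integral sign produces.  Its Taylor estimates come from those of the
  exponential under the integral.
\<close>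
definition char_deriv :: "real measure \<Rightarrow> nat \<Rightarrow> real \<Rightarrow> complex" where
  "char_deriv N j t = (CLINT x|N. (\<i> * of_real x) ^ j * iexp (t * x))"

lemma char_deriv_integrable:
  assumes "real_distribution N" and "integrable N (\<lambda>x. x ^ j)"
  shows "complex_integrable N (\<lambda>x. (\<i> * of_real x) ^ j * iexp (t * x))"
proof -
  interpret real_distribution N by fact
  show ?thesis
    by (rule Bochner_Integration.integrable_bound [OF assms(2)]) (simp_all add: norm_mult norm_power power_abs)
qed

lemma char_deriv_bound:
  "norm (char_deriv N j t) \<le> (\<integral>x. \<bar>x\<bar> ^ j \<partial>N)"
proof -
  have "norm (char_deriv N j t) \<le> (\<integral>x. norm ((\<i> * of_real x) ^ j * iexp (t * x)) \<partial>N)"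
    unfolding char_deriv_def by (rule integral_norm_bound)
  thus ?thesis by (simp add: norm_mult norm_power)
qed

lemma char_deriv_zero:
  "char_deriv N j 0 = \<i> ^ j * of_real (\<integral>x. x ^ j \<partial>N)"
proof -
  have "char_deriv N j 0 = (\<integral>x. \<i> ^ j * of_real (x ^ j) \<partial>N)"
    by (simp add: char_deriv_def power_mult_distrib)
  also have "\<dots> = \<i> ^ j * (\<integral>x. of_real (x ^ j) \<partial>N)"
    by (rule integral_mult_right_zero)
  finally show ?thesis by (simp only: integral_complex_of_real)
qed

lemma char_deriv_taylor:
  assumes N: "real_distribution N" and int: "\<And>n. integrable N (\<lambda>x. x ^ n)"
  shows "norm (char_deriv N j t - (\<Sum>i<n. of_real ((t - s) ^ i / fact i) * char_deriv N (i + j) s))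
    \<le> \<bar>t - s\<bar> ^ n / fact n * (\<integral>x. \<bar>x\<bar> ^ (n + j) \<partial>N)"
proof -
  interpret real_distribution N by fact
  let ?e = "\<lambda>j t x. (\<i> * complex_of_real x) ^ j * iexp (t * x)"
  have ci [simp]: "complex_integrable N (?e j t)" for j t
    by (rule char_deriv_integrable [OF N int])
  have si: "complex_integrable N (\<lambda>x. \<Sum>i<n. of_real ((t - s) ^ i / fact i) * ?e (i + j) s x)"
    by (rule Bochner_Integration.integrable_sum, rule integrable_mult_right, rule ci)
  have bi: "integrable N (\<lambda>x. \<bar>t - s\<bar> ^ n / fact n * \<bar>x\<bar> ^ (n + j))"
    using integrable_abs [OF int [of "n + j"]] by (intro integrable_mult_right) (simp add: power_abs)
  have ni: "integrable N (\<lambda>x. norm (?e j t x - (\<Sum>i<n. of_real ((t - s) ^ i / fact i) * ?e (i + j) s x)))"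
    using Bochner_Integration.integrable_diff [OF ci si] by (rule integrable_norm)
  have le: "norm (?e j t x - (\<Sum>i<n. of_real ((t - s) ^ i / fact i) * ?e (i + j) s x))
      \<le> \<bar>t - s\<bar> ^ n / fact n * \<bar>x\<bar> ^ (n + j)" for x
  proof -
    have iexp_split: "iexp (t * x) = iexp (s * x) * iexp ((t - s) * x)"
      by (simp add: exp_add [symmetric] algebra_simps)
    have "of_real ((t - s) ^ i / fact i) * ?e (i + j) s x
        = (\<i> * of_real x) ^ j * iexp (s * x) * ((\<i> * of_real ((t - s) * x)) ^ i / fact i)" for i
      by (simp add: power_add power_mult_distrib)
    hence "?e j t x - (\<Sum>i<n. of_real ((t - s) ^ i / fact i) * ?e (i + j) s x)
        = (\<i> * of_real x) ^ j * iexp (s * x) * (iexp ((t - s) * x) - (\<Sum>i<n. (\<i> * of_real ((t - s) * x)) ^ i / fact i))"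
      by (simp only: iexp_split right_diff_distrib sum_distrib_left mult.assoc)
    hence "norm (?e j t x - (\<Sum>i<n. of_real ((t - s) ^ i / fact i) * ?e (i + j) s x))
        = \<bar>x\<bar> ^ j * norm (iexp ((t - s) * x) - (\<Sum>i<n. (\<i> * of_real ((t - s) * x)) ^ i / fact i))"
      by (simp only: norm_mult norm_power) simp
    also have "\<dots> \<le> \<bar>x\<bar> ^ j * (\<bar>(t - s) * x\<bar> ^ n / fact n)"
      by (intro mult_left_mono iexp_taylor_remainder) simp
    also have "\<dots> = \<bar>t - s\<bar> ^ n / fact n * \<bar>x\<bar> ^ (n + j)"
      by (simp add: abs_mult power_mult_distrib power_add)
    finally show ?thesis .
  qed
  have "char_deriv N j t - (\<Sum>i<n. of_real ((t - s) ^ i / fact i) * char_deriv N (i + j) s)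
      = (\<integral>x. ?e j t x - (\<Sum>i<n. of_real ((t - s) ^ i / fact i) * ?e (i + j) s x) \<partial>N)"
    unfolding char_deriv_def
    by (simp only: Bochner_Integration.integral_diff [OF ci si] integral_mult_right_zero
          Bochner_Integration.integral_sum [OF integrable_mult_right [OF ci]])
  hence "norm (char_deriv N j t - (\<Sum>i<n. of_real ((t - s) ^ i / fact i) * char_deriv N (i + j) s))
      \<le> (\<integral>x. norm (?e j t x - (\<Sum>i<n. of_real ((t - s) ^ i / fact i) * ?e (i + j) s x)) \<partial>N)"
    by (simp only: integral_norm_bound)
  moreover have "\<dots> \<le> (\<integral>x. \<bar>t - s\<bar> ^ n / fact n * \<bar>x\<bar> ^ (n + j) \<partial>N)"
    using ni bi le by (rule integral_mono)
  moreover have "\<dots> = \<bar>t - s\<bar> ^ n / fact n * (\<integral>x. \<bar>x\<bar> ^ (n + j) \<partial>N)"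
    by (rule integral_mult_right_zero)
  ultimately show ?thesis
    by linarith
qed

text \<open>
  Carleman's theorem on the real line.  With \<open>m n\<close> the moment of order \<open>2 n\<close> and
  \<open>\<rho> n = sqrt (m (n + 1) / m n)\<close>, the product of the first \<open>j\<close> members of the sequence
  \<open>\<rho> 0, \<rho> 0, \<rho> 1, \<rho> 1, \<dots>\<close> is the even moment \<open>m (j div 2)\<close> for even \<open>j\<close> and the geometric mean of two
  consecutive even moments for odd \<open>j\<close>.  It depends on even moments only, it bounds the
  absolute moment of order \<open>j\<close> of both laws, and the sequence is increasing by log-convexity.
  The geometric means of the numbers \<open>1 / \<rho> k\<close> are the terms of Carleman's series, so the
  divergence of that series forces the sum of the \<open>1 / \<rho> k\<close> to diverge.
\<close>
theorem carleman_determines_distribution: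
  assumes distr: "real_distribution \<mu>" "real_distribution \<nu>"
    and int: "\<And>n. integrable \<mu> (\<lambda>x. x ^ n)" "\<And>n. integrable \<nu> (\<lambda>x. x ^ n)"
    and moments_eq: "\<And>n. (\<integral>x. x ^ n \<partial>\<mu>) = (\<integral>x. x ^ n \<partial>\<nu>)"
    and moments_pos: "\<And>n. 0 < (\<integral>x. x ^ (2 * n) \<partial>\<mu>)"
    and diverges: "\<not> summable (\<lambda>n. 1 / (\<integral>x. x ^ (2 * Suc n) \<partial>\<mu>) powr (1 / (2 * real (Suc n))))"
  shows "\<mu> = \<nu>"
proof -
  interpret mu: real_distribution \<mu> by fact
  define m where "m n = (\<integral>x. x ^ (2 * n) \<partial>\<mu>)" for n
  define \<rho> where "\<rho> n = sqrt (m (Suc n) / m n)" for n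
  define r where "r k = \<rho> (k div 2)" for k
  have m_pos: "0 < m n" for n
    by (simp add: m_def moments_pos)
  have m_0: "m 0 = 1"
    by (simp add: m_def mu.prob_space [unfolded mu.space_eq_univ])
  have \<rho>_pos: "0 < \<rho> n" for n
    by (simp add: \<rho>_def m_pos)
  have "m (Suc n) / m n \<le> m (Suc (Suc n)) / m (Suc n)" for n
  proof -
    have "(m (Suc n))\<^sup>2 \<le> m n * m (Suc (Suc n))"
      using moments_log_convex [of \<mu> "\<lambda>x. x\<^sup>2" n] int
      by (simp add: m_def power_mult [symmetric] del: power_Suc)
    thus ?thesis
      using m_pos by (simp add: field_simps power2_eq_square)
  qed
  hence "incseq \<rho>"
    unfolding \<rho>_def by (intro incseq_SucI) (rule real_sqrt_le_mono)
  hence "incseq r"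
    unfolding r_def incseq_def by (auto intro: div_le_mono)
  have prod_even: "(\<Prod>k<2 * n. r k) = m n" for n
  proof (induction n)
    case (Suc n)
    have "(\<Prod>k<2 * Suc n. r k) = m n * (\<rho> n * \<rho> n)"
      using Suc by (simp add: r_def)
    also have "\<dots> = m (Suc n)"
      using m_pos [of n] m_pos [of "Suc n"] by (simp add: \<rho>_def)
    finally show ?case .
  qed (simp add: m_0)
  have abs_moment: "(\<integral>x. \<bar>x\<bar> ^ j \<partial>\<kappa>) \<le> (\<Prod>k<j. r k)" if "\<kappa> \<in> {\<mu>, \<nu>}" for \<kappa> j
  proof -
    have int_abs: "integrable \<kappa> (\<lambda>x. \<bar>x\<bar> ^ n)" for n
      using that integrable_abs [OF int(1) [of n]] integrable_abs [OF int(2) [of n]] by (auto simp: power_abs)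
    have even: "(\<integral>x. \<bar>x\<bar> ^ (2 * n) \<partial>\<kappa>) = m n" for n
      using that moments_eq by (auto simp: m_def power_even_abs)
    show ?thesis
    proof (cases "even j")
      case True
      then obtain n where "j = 2 * n" by (elim evenE)
      thus ?thesis using even [of n] prod_even [of n] by simp
    next
      case False
      then obtain n where j: "j = Suc (2 * n)" by (elim oddE) simp
      have "(\<integral>x. \<bar>x\<bar> ^ j \<partial>\<kappa>)\<^sup>2 \<le> m n * m (Suc n)"
        using moments_log_convex [OF int_abs, of "2 * n"] even [of n] even [of "Suc n"]
        by (simp add: j)
      also have "\<dots> = (m n * \<rho> n)\<^sup>2"
        using m_pos [of n] m_pos [of "Suc n"]
        by (simp add: \<rho>_def power_mult_distrib) (simp add: power2_eq_square)
      finally have "(\<integral>x. \<bar>x\<bar> ^ j \<partial>\<kappa>) \<le> m n * \<rho> n"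
        by (rule power2_le_imp_le) (simp add: less_imp_le m_pos \<rho>_pos)
      thus ?thesis
        using prod_even [of n] by (simp add: j r_def)
    qed
  qed
  have r_diverges: "\<not> summable (\<lambda>k. 1 / r k)"
  proof
    assume "summable (\<lambda>k. 1 / r k)"
    hence "summable (\<lambda>n. 1 / \<rho> n)"
      using summable_reindex [of "\<lambda>k. 1 / r k" "\<lambda>n. 2 * n"]
      by (simp add: r_def o_def inj_on_def less_imp_le \<rho>_pos)
    hence "summable (\<lambda>n. (\<Prod>k<Suc n. 1 / \<rho> k) powr (1 / real (Suc n)))"
      by (intro summable_geometric_means) (simp_all add: less_imp_le \<rho>_pos)
    moreover have "(\<Prod>k<Suc n. 1 / \<rho> k) powr (1 / real (Suc n)) = 1 / m (Suc n) powr (1 / (2 * real (Suc n)))" for n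
    proof -
      have "(\<Prod>k<N. 1 / \<rho> k) = m N powr (- 1 / 2)" for N
      proof (induction N)
        case (Suc N)
        have "1 / \<rho> N = m (Suc N) powr (- 1 / 2) / m N powr (- 1 / 2)"
          using m_pos [of N] m_pos [of "Suc N"]
          by (simp add: \<rho>_def powr_minus powr_half_sqrt real_sqrt_divide field_simps)
        thus ?case using Suc m_pos [of N] by simp
      qed (simp add: m_0)
      hence "(\<Prod>k<Suc n. 1 / \<rho> k) powr (1 / real (Suc n)) = m (Suc n) powr (- (1 / (2 * real (Suc n))))"
        by (simp only: powr_powr) simp
      thus ?thesis
        by (simp only: powr_minus_divide)
    qed
    ultimately show False
      using diverges by (simp add: m_def del: mult_Suc_right)
  qed
  define D where "D j t = char_deriv \<mu> j t - char_deriv \<nu> j t" for j t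
  have "D 0 t = 0" for t
  proof (rule quasianalytic_vanishing [where r = r and c = 2])
    show "0 < r n" for n by (simp add: r_def \<rho>_pos)
    show "norm (D j t) \<le> 2 * (\<Prod>k<j. r k)" for j t
      using norm_triangle_ineq4 [of "char_deriv \<mu> j t" "char_deriv \<nu> j t"]
        char_deriv_bound [of \<mu> j t] char_deriv_bound [of \<nu> j t] abs_moment [of \<mu> j] abs_moment [of \<nu> j]
      by (simp add: D_def)
    show "D j 0 = 0" for j
      by (simp add: D_def char_deriv_zero moments_eq)
    fix j n and s t :: real
    define R where "R \<kappa> = char_deriv \<kappa> j t - (\<Sum>i<n. of_real ((t - s) ^ i / fact i) * char_deriv \<kappa> (i + j) s)" for \<kappa>
    have R_le: "norm (R \<kappa>) \<le> \<bar>t - s\<bar> ^ n / fact n * (\<Prod>k<n + j. r k)" if "\<kappa> \<in> {\<mu>, \<nu>}" for \<kappa>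
    proof -
      have "norm (R \<kappa>) \<le> \<bar>t - s\<bar> ^ n / fact n * (\<integral>x. \<bar>x\<bar> ^ (n + j) \<partial>\<kappa>)"
        unfolding R_def using that distr int by (intro char_deriv_taylor) auto
      also have "\<dots> \<le> \<bar>t - s\<bar> ^ n / fact n * (\<Prod>k<n + j. r k)"
        by (intro mult_left_mono abs_moment that) simp
      finally show ?thesis .
    qed
    have "D j t - (\<Sum>i<n. of_real ((t - s) ^ i / fact i) * D (i + j) s) = R \<mu> - R \<nu>"
      unfolding D_def R_def by (simp add: right_diff_distrib sum_subtractf)
    moreover have "norm (R \<mu> - R \<nu>) \<le> 2 * (\<bar>t - s\<bar> ^ n / fact n * (\<Prod>k<n + j. r k))"
      using norm_triangle_ineq4 [of "R \<mu>" "R \<nu>"] R_le [of \<mu>] R_le [of \<nu>] by simp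
    ultimately show "norm (D j t - (\<Sum>i<n. of_real ((t - s) ^ i / fact i) * D (i + j) s))
        \<le> \<bar>t - s\<bar> ^ n / fact n * (2 * (\<Prod>k<n + j. r k))"
      by (simp only: mult.left_commute)
  qed (fact \<open>incseq r\<close> r_diverges)+
  hence "char \<mu> = char \<nu>"
    by (auto simp: D_def char_deriv_def char_def fun_eq_iff)
  with distr show ?thesis
    by (rule Levy_uniqueness)
qed

section \<open>Carleman's criterion on the half-line\<close>

text \<open>
  The law of a square root with an independent fair random sign.  With the absolute value under
  the root, squaring returns \<open>\<bar>x\<bar>\<close> for every \<open>x\<close>, also on a null set of negative \<open>x\<close>.
\<close>
definition symmetric_sqrt :: "real measure \<Rightarrow> real measure" where
  "symmetric_sqrt N = distr (N \<Otimes>\<^sub>M measure_pmf (bernoulli_pmf (1/2))) borel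
     (\<lambda>(x, b). if b then sqrt \<bar>x\<bar> else - sqrt \<bar>x\<bar>)"

context
  fixes N :: "real measure"
  assumes N: "real_distribution N" and nonneg: "nonneg_with_finite_moments N (\<lambda>x. x)"
begin

interpretation real_distribution N by (fact N)

lemma distr_fst: "distr (N \<Otimes>\<^sub>M measure_pmf p) N fst = N"
  by (rule prob_space.distr_pair_fst) (rule measure_pmf.prob_space_axioms)

interpretation pair_prob_space N "measure_pmf (bernoulli_pmf (1/2))" ..

lemma signed_sqrt_measurable:
  "(\<lambda>(x, b). if b then sqrt \<bar>x\<bar> else - sqrt \<bar>x\<bar>)
     \<in> borel_measurable (N \<Otimes>\<^sub>M measure_pmf (bernoulli_pmf (1/2)))"
proof -
  have [measurable]: "Measurable.pred (N \<Otimes>\<^sub>M measure_pmf (bernoulli_pmf (1/2))) snd"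
    by (rule measurable_compose [OF measurable_snd]) simp
  have [measurable]: "fst \<in> borel_measurable (N \<Otimes>\<^sub>M measure_pmf (bernoulli_pmf (1/2)))"
    by (rule measurable_compose [OF measurable_fst]) simp
  show ?thesis
    unfolding case_prod_beta by measurable
qed

lemma real_distribution_symmetric_sqrt: "real_distribution (symmetric_sqrt N)"
  unfolding symmetric_sqrt_def
  using P.real_distribution_distr [OF signed_sqrt_measurable] .

lemma finite_moments: "integrable N (\<lambda>x. x ^ n)"
  using nonneg by (cases "n = 0") (auto simp: nonneg_with_finite_moments_def)

lemma integrable_sqrt_power: "integrable N (\<lambda>x. sqrt \<bar>x\<bar> ^ n)"
proof (rule Bochner_Integration.integrable_bound)
  show "integrable N (\<lambda>x. 1 + \<bar>x ^ n\<bar>)"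
    using finite_moments [of n] by simp
  have "sqrt \<bar>x\<bar> ^ n \<le> 1 + \<bar>x\<bar> ^ n" for x
  proof (cases "\<bar>x\<bar> \<le> 1")
    case True
    hence "sqrt \<bar>x\<bar> ^ n \<le> 1" by (intro power_le_one) auto
    thus ?thesis by (simp add: add_increasing2)
  next
    case False
    hence "sqrt \<bar>x\<bar> \<le> \<bar>x\<bar>"
      using self_le_power [of "\<bar>x\<bar>" 2] by (intro real_le_lsqrt) auto
    hence "sqrt \<bar>x\<bar> ^ n \<le> \<bar>x\<bar> ^ n" by (intro power_mono) auto
    thus ?thesis by simp
  qed
  thus "AE x in N. norm (sqrt \<bar>x\<bar> ^ n) \<le> norm (1 + \<bar>x ^ n\<bar>)"
    by (simp add: power_abs)
qed simp

lemma integrable_symmetric_sqrt: "integrable (symmetric_sqrt N) (\<lambda>x. x ^ n)"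
proof -
  have "integrable (N \<Otimes>\<^sub>M measure_pmf (bernoulli_pmf (1/2))) (\<lambda>z. sqrt \<bar>fst z\<bar> ^ n)"
    using integrable_sqrt_power [of n]
      integrable_distr_eq [of fst "N \<Otimes>\<^sub>M measure_pmf (bernoulli_pmf (1/2))" N "\<lambda>x. sqrt \<bar>x\<bar> ^ n"]
    by (simp add: distr_fst)
  hence "integrable (N \<Otimes>\<^sub>M measure_pmf (bernoulli_pmf (1/2)))
      (\<lambda>z. (case z of (x, b) \<Rightarrow> if b then sqrt \<bar>x\<bar> else - sqrt \<bar>x\<bar>) ^ n)"
    by (rule Bochner_Integration.integrable_bound)
       (use signed_sqrt_measurable in \<open>auto intro!: borel_measurable_power simp: power_abs\<close>)
  thus ?thesis
    unfolding symmetric_sqrt_def by (subst integrable_distr_eq [OF signed_sqrt_measurable]) simp_all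
qed

lemma moments_symmetric_sqrt:
  "(\<integral>x. x ^ n \<partial>symmetric_sqrt N) = (if even n then \<integral>x. x ^ (n div 2) \<partial>N else 0)"
proof -
  let ?f = "\<lambda>z. (case z of (x, b) \<Rightarrow> if b then sqrt \<bar>x\<bar> else - sqrt \<bar>x\<bar>) ^ n"
  have "(\<integral>x. x ^ n \<partial>symmetric_sqrt N) = (\<integral>z. ?f z \<partial>(N \<Otimes>\<^sub>M measure_pmf (bernoulli_pmf (1/2))))"
    unfolding symmetric_sqrt_def by (subst integral_distr [OF signed_sqrt_measurable]) simp_all
  also have "\<dots> = (\<integral>x. (\<integral>b. ?f (x, b) \<partial>bernoulli_pmf (1/2)) \<partial>N)"
    using integrable_symmetric_sqrt [of n] unfolding symmetric_sqrt_def
    by (subst integral_fst') (simp_all add: integrable_distr_eq [OF signed_sqrt_measurable])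
  also have "\<dots> = (\<integral>x. (sqrt \<bar>x\<bar> ^ n + (- sqrt \<bar>x\<bar>) ^ n) / 2 \<partial>N)"
    by (simp add: field_simps)
  also have "\<dots> = (if even n then \<integral>x. x ^ (n div 2) \<partial>N else 0)"
  proof (cases "even n")
    case True
    then obtain k where n: "n = 2 * k" by (elim evenE)
    have "(\<integral>x. (sqrt \<bar>x\<bar> ^ n + (- sqrt \<bar>x\<bar>) ^ n) / 2 \<partial>N) = (\<integral>x. \<bar>x\<bar> ^ k \<partial>N)"
      by (simp add: n power_mult)
    also have "\<dots> = (\<integral>x. x ^ k \<partial>N)"
      using nonneg by (intro integral_cong_AE) (auto simp: nonneg_with_finite_moments_def)
    finally show ?thesis by (simp add: n)
  qed simp
  finally show ?thesis .
qed

text \<open>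
  A law on the half-line is recovered from its symmetrization, so that determinacy can be transferred
  back from the real line.
\<close>
lemma distr_square_symmetric_sqrt: "distr (symmetric_sqrt N) borel (\<lambda>x. x\<^sup>2) = N"
proof -
  have "distr (symmetric_sqrt N) borel (\<lambda>x. x\<^sup>2)
      = distr (N \<Otimes>\<^sub>M measure_pmf (bernoulli_pmf (1/2))) borel (\<lambda>z. \<bar>fst z\<bar>)"
    unfolding symmetric_sqrt_def
    by (subst distr_distr [OF _ signed_sqrt_measurable]) (auto intro!: distr_cong)
  also have "\<dots> = distr (distr (N \<Otimes>\<^sub>M measure_pmf (bernoulli_pmf (1/2))) N fst) borel (\<lambda>x. \<bar>x\<bar>)"
    by (subst distr_distr) (simp_all add: o_def)
  also have "\<dots> = distr N borel (\<lambda>x. \<bar>x\<bar>)"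
    by (simp add: distr_fst)
  also have "\<dots> = distr N N (\<lambda>x. x)"
    using nonneg by (intro distr_cong_AE) (auto simp: nonneg_with_finite_moments_def)
  finally show ?thesis
    by simp
qed

end

text \<open>
  If all moments are positive, the symmetrized square roots of the two laws fall under Carleman's
  theorem on the line.  If some moment vanishes, Carleman's series is infinite for trivial reasons,
  and both laws are the point mass at \<open>0\<close>.
\<close>
theorem carleman_S_imp_M_det:
  assumes M: "prob_space M" and carleman: "carleman_S M W"
  shows "M_det_nonneg M W"
  unfolding M_det_nonneg_def
proof (intro conjI allI impI)
  interpret prob_space M by fact
  show nn: "nonneg_with_finite_moments M W"
    using carleman by (simp add: carleman_S_def)
  hence W [measurable]: "W \<in> borel_measurable M" and W_nonneg: "AE \<omega> in M. 0 \<le> W \<omega>"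
    and int_W: "\<And>n. n \<ge> 1 \<Longrightarrow> integrable M (\<lambda>\<omega>. W \<omega> ^ n)"
    by (auto simp: nonneg_with_finite_moments_def)
  fix N assume asm: "real_distribution N \<and> nonneg_with_finite_moments N (\<lambda>x. x) \<and>
    (\<forall>n\<ge>1. (\<integral>x. x ^ n \<partial>N) = (\<integral>\<omega>. W \<omega> ^ n \<partial>M))"
  hence N: "real_distribution N" "nonneg_with_finite_moments N (\<lambda>x. x)"
    and moments: "\<And>n. n \<ge> 1 \<Longrightarrow> (\<integral>x. x ^ n \<partial>N) = (\<integral>\<omega>. W \<omega> ^ n \<partial>M)"
    by auto
  interpret N: real_distribution N by fact
  define L where "L = distr M borel W"
  have L: "real_distribution L"
    unfolding L_def by simp
  have L_nonneg: "nonneg_with_finite_moments L (\<lambda>x. x)"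
    using W_nonneg int_W by (auto simp: nonneg_with_finite_moments_def L_def AE_distr_iff integrable_distr_eq)
  have L_moments: "(\<integral>x. x ^ n \<partial>L) = (\<integral>\<omega>. W \<omega> ^ n \<partial>M)" for n
    unfolding L_def by (subst integral_distr) simp_all
  have moments_eq: "(\<integral>x. x ^ n \<partial>L) = (\<integral>x. x ^ n \<partial>N)" for n
    using moments [of n] L_moments [of n] N.prob_space prob_space by (cases "n = 0") simp_all
  have "0 \<le> (\<integral>\<omega>. W \<omega> ^ n \<partial>M)" for n
    using W_nonneg by (intro integral_nonneg_AE) auto
  then consider (pos) "\<And>n. 0 < (\<integral>\<omega>. W \<omega> ^ n \<partial>M)" | (zero) n where "(\<integral>\<omega>. W \<omega> ^ n \<partial>M) = 0"
    by (metis order_le_less)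
  thus "N = distr M borel W"
  proof cases
    case zero
    have "n \<noteq> 0"
      using zero prob_space by (cases "n = 0") auto
    have dirac: "K = return borel 0"
      if "real_distribution K" "nonneg_with_finite_moments K (\<lambda>x. x)" "(\<integral>x. x ^ n \<partial>K) = 0" for K
    proof -
      interpret K: real_distribution K by fact
      have "AE x in K. x ^ n = 0"
        using that \<open>n \<noteq> 0\<close>
        by (subst (asm) integral_nonneg_eq_0_iff_AE) (auto simp: nonneg_with_finite_moments_def)
      hence "distr K K (\<lambda>x. x) = distr K borel (\<lambda>x. 0)"
        by (intro distr_cong_AE) (auto elim: AE_mp)
      thus ?thesis
        by simp
    qed
    have "L = return borel 0"
      using L L_nonneg zero L_moments by (intro dirac) simp_all
    moreover have "N = return borel 0"
      using N zero moments_eq [of n] L_moments [of n] by (intro dirac) simp_all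
    ultimately show ?thesis
      by (simp add: L_def)
  next
    case pos
    have even_moments: "(\<integral>x. x ^ (2 * k) \<partial>symmetric_sqrt L) = (\<integral>\<omega>. W \<omega> ^ k \<partial>M)" for k
      by (simp add: moments_symmetric_sqrt [OF L L_nonneg] L_moments)
    have "symmetric_sqrt L = symmetric_sqrt N"
    proof (rule carleman_determines_distribution)
      show "\<not> summable (\<lambda>n. 1 / (\<integral>x. x ^ (2 * Suc n) \<partial>symmetric_sqrt L) powr (1 / (2 * real (Suc n))))"
      proof
        let ?c = "\<lambda>n. 1 / (\<integral>\<omega>. W \<omega> ^ Suc n \<partial>M) powr (1 / (2 * real (Suc n)))"
        assume "summable (\<lambda>n. 1 / (\<integral>x. x ^ (2 * Suc n) \<partial>symmetric_sqrt L) powr (1 / (2 * real (Suc n))))"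
        hence "summable ?c"
          by (simp only: even_moments)
        hence "(\<Sum>n. ennreal (?c n)) \<noteq> \<infinity>"
          by (subst suminf_ennreal2) auto
        moreover have "inverse (ennreal ((\<integral>\<omega>. W \<omega> ^ Suc n \<partial>M) powr (1 / (2 * real (Suc n))))) = ennreal (?c n)" for n
          using inverse_ennreal [of "(\<integral>\<omega>. W \<omega> ^ Suc n \<partial>M) powr (1 / (2 * real (Suc n)))"] pos [THEN less_imp_neq, of "Suc n"]
          by (simp only: powr_gt_zero inverse_eq_divide not_False_eq_True)
        hence "(\<Sum>n. ennreal (?c n)) = \<infinity>"
          using carleman by (simp only: carleman_S_def)
        ultimately show False by contradiction
      qed
    qed (simp_all add: real_distribution_symmetric_sqrt integrable_symmetric_sqrt moments_symmetric_sqrt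
           L L_nonneg N moments_eq, simp add: moments_eq [symmetric] L_moments pos)
    thus ?thesis
      using distr_square_symmetric_sqrt [OF L L_nonneg] distr_square_symmetric_sqrt [OF N]
      unfolding L_def [symmetric] by argo
  qed
qed

section \<open>Laws with a density on a half-line\<close>

text \<open>
  Both measures assign the mass \<open>cdf N x - cdf N b\<close> to \<open>{..x}\<close> for \<open>x \<ge> b\<close>, and none for
  \<open>x < b\<close>, so uniqueness of distribution functions identifies them.  Measurability of \<open>g\<close>
  beyond \<open>b\<close> is extracted from integrability on the compact intervals \<open>[b, b + n]\<close>.
\<close>
lemma restriction_eq_density:
  assumes N: "real_distribution N" and ac: "absolutely_continuous_with_density_from (cdf N) b g"
    and g_nonneg: "\<And>x. x \<ge> b \<Longrightarrow> 0 \<le> g x"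
  shows "(\<lambda>x. g x * indicator {b<..} x) \<in> borel_measurable borel"
    and "density N (indicator {b<..}) = density lborel (\<lambda>x. ennreal (g x * indicator {b<..} x))"
proof -
  interpret real_distribution N by fact
  let ?h = "\<lambda>x. g x * indicator {b<..} x"
  have si: "set_integrable lborel {b..x} g" and cdf_eq: "cdf N x - cdf N b = (LBINT t:{b..x}. g t)"
    if "b \<le> x" for x
    using ac that unfolding absolutely_continuous_with_density_from_def by auto
  show meas: "?h \<in> borel_measurable borel"
  proof (rule borel_measurable_LIMSEQ_real)
    have "(\<lambda>x. indicator {b..b + real n} x *\<^sub>R g x) \<in> borel_measurable borel" for n
      using si [of "b + real n"] by (simp add: set_integrable_def)
    thus "(\<lambda>x. indicator {b..b + real n} x *\<^sub>R g x * indicator {b<..} x) \<in> borel_measurable borel" for n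
      by measurable
    fix x
    have "eventually (\<lambda>n. x \<le> b + real n) sequentially"
      by real_asymp
    hence "eventually (\<lambda>n. indicator {b..b + real n} x *\<^sub>R g x * indicator {b<..} x = ?h x) sequentially"
      by eventually_elim (auto simp: indicator_def)
    thus "(\<lambda>n. indicator {b..b + real n} x *\<^sub>R g x * indicator {b<..} x) \<longlonglongrightarrow> ?h x"
      by (rule tendsto_eventually)
  qed
  define N1 where "N1 = density N (indicator {b<..})"
  define N2 where "N2 = density lborel (\<lambda>x. ennreal (?h x))"
  have N1: "emeasure N1 {..x} = ennreal (if b \<le> x then cdf N x - cdf N b else 0)" for x
  proof -
    have "emeasure N1 {..x} = emeasure N ({b<..} \<inter> {..x})"
      by (simp add: N1_def emeasure_density flip: indicator_inter_arith)
    also have "{b<..} \<inter> {..x} = {b<..x}" by auto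
    also have "emeasure N {b<..x} = ennreal (if b \<le> x then cdf N x - cdf N b else 0)"
      using cdf_diff_eq [of b x] by (cases "b < x") (auto simp: emeasure_eq_measure)
    finally show ?thesis .
  qed
  have N2: "emeasure N2 {..x} = ennreal (if b \<le> x then cdf N x - cdf N b else 0)" for x
  proof (cases "b \<le> x")
    case True
    have "emeasure N2 {..x} = (\<integral>\<^sup>+t. ennreal (?h t) * indicator {..x} t \<partial>lborel)"
      using meas by (simp add: N2_def emeasure_density)
    also have "\<dots> = (\<integral>\<^sup>+t. ennreal (indicator {b..x} t *\<^sub>R g t) \<partial>lborel)"
      by (intro nn_integral_cong_AE, use AE_lborel_singleton [of b] in eventually_elim)
         (auto simp: indicator_def)
    also have "\<dots> = ennreal (LBINT t:{b..x}. g t)"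
      unfolding set_lebesgue_integral_def using si [OF True] g_nonneg
      by (intro nn_integral_eq_integral) (auto simp: set_integrable_def indicator_def)
    finally show ?thesis using True by (simp add: cdf_eq)
  next
    case False
    have "emeasure N2 {..x} = (\<integral>\<^sup>+t. ennreal (?h t) * indicator {..x} t \<partial>lborel)"
      using meas by (simp add: N2_def emeasure_density)
    also have "\<dots> = (\<integral>\<^sup>+t. 0 \<partial>(lborel :: real measure))"
      using False by (intro nn_integral_cong) (auto simp: indicator_def)
    finally show ?thesis using False by simp
  qed
  have fin: "finite_borel_measure K"
    if K: "sets K = sets borel" "\<And>x. emeasure K {..x} = ennreal (if b \<le> x then cdf N x - cdf N b else 0)" for K
  proof (intro finite_borel_measure.intro finite_measureI finite_borel_measure_axioms.intro)
    have "(\<Union>n. {..real n}) = space K"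
      using sets_eq_imp_space_eq [OF K(1)] by (auto intro: real_arch_simple)
    moreover have "(SUP n. emeasure K {..real n}) = emeasure K (\<Union>n. {..real n})"
    proof (rule SUP_emeasure_incseq)
      show "range (\<lambda>n. {..real n}) \<subseteq> sets K"
        unfolding K(1) by (simp add: image_subset_iff)
      show "incseq (\<lambda>n. {..real n})"
        by (simp add: incseq_def)
    qed
    moreover have "(SUP n. emeasure K {..real n}) \<le> 1"
    proof (rule SUP_least)
      fix n
      have "cdf N (real n) - cdf N b \<le> 1"
        using cdf_bounded_prob [of "real n"] cdf_nonneg [of b] by linarith
      thus "emeasure K {..real n} \<le> 1"
        by (simp add: K(2))
    qed
    ultimately show "emeasure K (space K) \<noteq> \<infinity>"
      by (auto simp: top_unique)
  qed fact
  have "N1 = N2"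
  proof (rule cdf_unique')
    show "cdf N1 = cdf N2"
      by (simp add: cdf_def measure_def N1 N2 fun_eq_iff)
    show "finite_borel_measure N1"
      by (rule fin [OF _ N1]) (simp add: N1_def)
    show "finite_borel_measure N2"
      by (rule fin [OF _ N2]) (simp add: N2_def)
  qed
  thus "density N (indicator {b<..}) = density lborel (\<lambda>x. ennreal (?h x))"
    by (simp add: N1_def N2_def)
qed

lemma nn_integral_above_eq_density:
  assumes N: "real_distribution N" and ac: "absolutely_continuous_with_density_from (cdf N) b g"
    and g_nonneg: "\<And>x. x \<ge> b \<Longrightarrow> 0 \<le> g x"
    and f [measurable]: "f \<in> borel_measurable borel"
  shows "(\<integral>\<^sup>+x. indicator {b<..} x * f x \<partial>N) = (\<integral>\<^sup>+x. ennreal (g x * indicator {b<..} x) * f x \<partial>lborel)"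
proof -
  interpret real_distribution N by fact
  note [measurable] = restriction_eq_density(1) [OF N ac g_nonneg]
  have "(\<integral>\<^sup>+x. indicator {b<..} x * f x \<partial>N) = (\<integral>\<^sup>+x. f x \<partial>density N (indicator {b<..}))"
    by (simp add: nn_integral_density)
  also have "\<dots> = (\<integral>\<^sup>+x. f x \<partial>density lborel (\<lambda>x. ennreal (g x * indicator {b<..} x)))"
    by (simp only: restriction_eq_density(2) [OF N ac g_nonneg])
  also have "\<dots> = (\<integral>\<^sup>+x. ennreal (g x * indicator {b<..} x) * f x \<partial>lborel)"
    by (rule nn_integral_density) simp_all
  finally show ?thesis .
qed

section \<open>Growth of moments from geometric decay of the density\<close>

text \<open>
  Let \<open>J u v\<close> be the integral of \<open>x\<^sup>n g x\<close> over \<open>[u, v]\<close>.  Substituting \<open>T\<close> gives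
  \<open>J (T R) (T B) \<le> \<theta> J R B\<close>, whence \<open>J R (T B) \<le> (T R)\<^sup>n + \<theta> J R (T B)\<close>.  On compact intervals \<open>J\<close> is
  finite, so the last summand may be absorbed into the left-hand side; then \<open>B\<close> tends to
  infinity.
\<close>
lemma moment_le_of_tail_contraction:
  fixes T T' :: "real \<Rightarrow> real"
  assumes N: "real_distribution N" and nonneg: "nonneg_with_finite_moments N (\<lambda>x. x)"
    and ac: "absolutely_continuous_with_density_from (cdf N) b g"
    and g_nonneg: "\<And>x. x \<ge> b \<Longrightarrow> 0 \<le> g x"
    and R: "b < R" "0 < R" and "n \<ge> 1" and \<theta>: "0 \<le> \<theta>" "\<theta> < 1"
    and T: "\<And>x. R \<le> x \<Longrightarrow> (T has_real_derivative T' x) (at x)" "continuous_on {R..} T'"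
      "\<And>x. R \<le> x \<Longrightarrow> 0 \<le> T' x" "\<And>x. R \<le> x \<Longrightarrow> x \<le> T x"
    and contraction: "\<And>x. R \<le> x \<Longrightarrow> T x ^ n * g (T x) * T' x \<le> \<theta> * (x ^ n * g x)"
  shows "(\<integral>x. x ^ n \<partial>N) \<le> R ^ n + T R ^ n / (1 - \<theta>)"
proof -
  interpret real_distribution N by fact
  define h where "h x = g x * indicator {b<..} x" for x
  have h [measurable]: "h \<in> borel_measurable borel"
    unfolding h_def by (rule restriction_eq_density(1) [OF N ac g_nonneg])
  have h_nonneg: "0 \<le> h x" for x
    by (simp add: h_def indicator_def g_nonneg)
  have density: "(\<integral>\<^sup>+x. indicator {b<..} x * f x \<partial>N) = (\<integral>\<^sup>+x. ennreal (h x) * f x \<partial>lborel)"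
    if "f \<in> borel_measurable borel" for f
    unfolding h_def by (rule nn_integral_above_eq_density [OF N ac g_nonneg that])
  have mass: "(\<integral>\<^sup>+x. ennreal (h x) \<partial>lborel) \<le> 1"
  proof -
    have "(\<integral>\<^sup>+x. ennreal (h x) \<partial>lborel) = (\<integral>\<^sup>+x. indicator {b<..} x \<partial>N)"
      using density [of "\<lambda>_. 1"] by simp
    also have "\<dots> \<le> 1"
      by (simp add: emeasure_le_1)
    finally show ?thesis .
  qed
  define J where "J u v = (\<integral>\<^sup>+x. ennreal (h x) * (ennreal (x ^ n) * indicator {u..v} x) \<partial>lborel)" for u v
  define c where "c = T R ^ n / (1 - \<theta>)"
  have T_R: "0 < T R" "R \<le> T R"
    using T(4) [of R] R by auto
  have J_le: "J R v \<le> ennreal (v ^ n)" for v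
  proof -
    have "J R v \<le> (\<integral>\<^sup>+x. ennreal (v ^ n) * ennreal (h x) \<partial>lborel)"
      unfolding J_def
    proof (rule nn_integral_mono)
      fix x
      have "ennreal (x ^ n) * indicator {R..v} x \<le> ennreal (v ^ n)"
        using R by (auto simp: indicator_def intro!: ennreal_leI power_mono)
      thus "ennreal (h x) * (ennreal (x ^ n) * indicator {R..v} x) \<le> ennreal (v ^ n) * ennreal (h x)"
        by (subst mult.commute) (rule mult_right_mono, simp_all)
    qed
    also have "\<dots> = ennreal (v ^ n) * (\<integral>\<^sup>+x. ennreal (h x) \<partial>lborel)"
      by (rule nn_integral_cmult) simp
    also have "\<dots> \<le> ennreal (v ^ n) * 1"
      by (rule mult_left_mono [OF mass]) simp
    finally show ?thesis by simp
  qed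
  have J_bound: "J R B \<le> ennreal c" if B: "R < B" for B
  proof -
    have "J (T R) (T B) = (\<integral>\<^sup>+x. (ennreal (h x) * ennreal (x ^ n)) * indicator {T R..T B} x \<partial>lborel)"
      by (simp add: J_def mult.assoc)
    also have "\<dots> = (\<integral>\<^sup>+x. (ennreal (h (T x)) * ennreal (T x ^ n)) * T' x * indicator {R..B} x \<partial>lborel)"
      by (rule nn_integral_substitution_aux)
         (use B T in \<open>auto intro: continuous_on_subset [where s = "{R..}"]\<close>)
    also have "\<dots> \<le> (\<integral>\<^sup>+x. ennreal \<theta> * (ennreal (h x) * (ennreal (x ^ n) * indicator {R..B} x)) \<partial>lborel)"
    proof (rule nn_integral_mono)
      fix x
      show "(ennreal (h (T x)) * ennreal (T x ^ n)) * T' x * indicator {R..B} x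
          \<le> ennreal \<theta> * (ennreal (h x) * (ennreal (x ^ n) * indicator {R..B} x))"
      proof (cases "x \<in> {R..B}")
        case True
        hence x: "R \<le> x" "b < x" "b < T x" "0 < x" "0 < T x"
          using R T(4) [of x] by auto
        have "ennreal (h (T x)) * ennreal (T x ^ n) * T' x = ennreal (T x ^ n * g (T x) * T' x)"
          using x T(3) [of x] g_nonneg [of "T x"]
          by (simp add: h_def ennreal_mult mult_ac)
        also have "\<dots> \<le> ennreal (\<theta> * (x ^ n * g x))"
          by (intro ennreal_leI contraction x)
        also have "\<dots> = ennreal \<theta> * (ennreal (h x) * ennreal (x ^ n))"
          using x \<theta> g_nonneg [of x] by (simp add: h_def ennreal_mult mult_ac)
        finally show ?thesis using True by simp
      qed simp
    qed
    also have "\<dots> = ennreal \<theta> * J R B"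
      unfolding J_def by (rule nn_integral_cmult) simp
    finally have step: "J (T R) (T B) \<le> ennreal \<theta> * J R B" .
    have J_mono: "J R B \<le> J R (T B)"
      using T(4) [of B] B unfolding J_def
      by (intro nn_integral_mono mult_left_mono) (auto simp: indicator_def)
    have "J R (T B) \<le> J R (T R) + J (T R) (T B)"
      unfolding J_def by (subst nn_integral_add [symmetric], simp, simp, intro nn_integral_mono)
        (auto simp: indicator_def)
    also have "\<dots> \<le> ennreal (T R ^ n) + ennreal \<theta> * J R (T B)"
      by (intro add_mono J_le order_trans [OF step] mult_left_mono J_mono) simp
    finally have le: "J R (T B) \<le> ennreal (T R ^ n) + ennreal \<theta> * J R (T B)" .
    have "J R (T B) < \<infinity>"
      using J_le [of "T B"] by (rule le_less_trans) simp
    then obtain j where j: "J R (T B) = ennreal j" "0 \<le> j"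
      by (cases "J R (T B)") auto
    have "j \<le> T R ^ n + \<theta> * j"
      using le j T_R \<theta> by (simp add: ennreal_mult [symmetric] ennreal_plus [symmetric] del: ennreal_plus)
    hence "j \<le> c"
      using \<theta> by (simp add: c_def field_simps)
    with J_mono j show ?thesis
      by (metis ennreal_leI order_trans)
  qed
  have c_nonneg: "0 \<le> c"
    using T_R \<theta> by (simp add: c_def)
  let ?tail = "\<lambda>x. ennreal (x ^ n) * indicator {R..} x"
  have "(\<integral>\<^sup>+x. ennreal (h x) * ?tail x \<partial>lborel) \<le> ennreal c"
  proof -
    have "(\<integral>\<^sup>+x. ennreal (h x) * ?tail x \<partial>lborel)
        = (\<integral>\<^sup>+x. (SUP k. ennreal (h x) * (ennreal (x ^ n) * indicator {R..R + real (Suc k)} x)) \<partial>lborel)"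
    proof (intro nn_integral_cong antisym SUP_least)
      fix x
      obtain k where "x - R \<le> real k"
        using real_arch_simple by blast
      hence "?tail x = ennreal (x ^ n) * indicator {R..R + real (Suc k)} x"
        by (auto simp: indicator_def)
      thus "ennreal (h x) * ?tail x \<le> (SUP k. ennreal (h x) * (ennreal (x ^ n) * indicator {R..R + real (Suc k)} x))"
        by (intro SUP_upper2 [of k]) simp_all
    qed (auto simp: indicator_def)
    also have "\<dots> = (SUP k. J R (R + real (Suc k)))"
      unfolding J_def
      by (rule nn_integral_monotone_convergence_SUP)
         (auto simp: incseq_def le_fun_def indicator_def intro!: mult_left_mono)
    also have "\<dots> \<le> ennreal c"
      by (intro SUP_least J_bound) simp
    finally show ?thesis .
  qed
  hence tail: "(\<integral>\<^sup>+x. indicator {b<..} x * ?tail x \<partial>N) \<le> ennreal c"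
    by (subst density) simp_all
  have pos: "AE x in N. 0 \<le> x" and int: "integrable N (\<lambda>x. x ^ n)"
    using nonneg \<open>n \<ge> 1\<close> by (auto simp: nonneg_with_finite_moments_def)
  have "ennreal (\<integral>x. x ^ n \<partial>N) = (\<integral>\<^sup>+x. ennreal (x ^ n) \<partial>N)"
    using int pos by (intro nn_integral_eq_integral [symmetric]) auto
  also have "\<dots> \<le> (\<integral>\<^sup>+x. ennreal (R ^ n) + indicator {b<..} x * ?tail x \<partial>N)"
    using pos
  proof (intro nn_integral_mono_AE, eventually_elim)
    case (elim x)
    show ?case
    proof (cases "x < R")
      case True
      hence "ennreal (x ^ n) \<le> ennreal (R ^ n)"
        using elim by (intro ennreal_leI power_mono) auto
      thus ?thesis by (rule order_trans) simp
    next
      case False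
      thus ?thesis using R by simp
    qed
  qed
  also have "\<dots> = ennreal (R ^ n) + (\<integral>\<^sup>+x. indicator {b<..} x * ?tail x \<partial>N)"
    by (subst nn_integral_add) (simp_all add: emeasure_space_1 [unfolded space_eq_univ])
  also have "\<dots> \<le> ennreal (R ^ n) + ennreal c"
    by (intro add_left_mono tail)
  also have "\<dots> = ennreal (R ^ n + c)"
    using R c_nonneg by simp
  finally show ?thesis
    using R c_nonneg by (subst (asm) ennreal_le_iff) (auto simp: c_def)
qed

text \<open>
  The contraction is applied with \<open>T x = x + a (ln x)\<^sup>\<alpha>\<close> and \<open>R = K n ln n\<close>, where \<open>K\<close> does not
  depend on \<open>n\<close>.  Because \<open>ln x / x\<close> decreases, \<open>n a ln x / x \<le> \<eta> K\<close> holds on all of \<open>[R, \<infinity>)\<close>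
  with \<open>\<eta> K = a (ln K + 2) / K\<close>, a quantity that tends to \<open>0\<close> as \<open>K\<close> grows.  Orders \<open>n \<ge> 3\<close> are
  those for which \<open>ln n \<ge> 1\<close> is guaranteed by \<open>e \<le> 3\<close>.
\<close>
lemma moment_growth:
  assumes N: "real_distribution N" and nonneg: "nonneg_with_finite_moments N (\<lambda>x. x)"
    and ac: "absolutely_continuous_with_density_from (cdf N) b g"
    and g_pos: "\<And>x. x \<ge> b \<Longrightarrow> 0 < g x"
    and a: "0 < a" and \<alpha>: "0 \<le> \<alpha>" "\<alpha> \<le> 1"
    and q: "0 < q" "q < 1" and decay: "\<And>x. x \<ge> x1 \<Longrightarrow> g (x + a * ln x powr \<alpha>) \<le> q * g x"
  shows "\<exists>C\<ge>1. \<forall>n\<ge>3. (\<integral>x. x ^ n \<partial>N) \<le> (C * (real n * ln (real n))) ^ n"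
proof -
  define \<theta> where "\<theta> = (1 + q) / 2"
  have \<theta>: "q < \<theta>" "0 < \<theta>" "\<theta> < 1"
    using q by (auto simp: \<theta>_def)
  define \<eta> where "\<eta> K = a * (ln K + 2) / K" for K
  have "((\<lambda>K. q * (1 + a / K) * exp (\<eta> K)) \<longlongrightarrow> q * (1 + 0) * exp 0) at_top"
    unfolding \<eta>_def by (intro tendsto_intros; real_asymp)
  hence "eventually (\<lambda>K. q * (1 + a / K) * exp (\<eta> K) < \<theta>) at_top"
    using \<theta> by (intro order_tendstoD) simp_all
  moreover have "(\<eta> \<longlongrightarrow> 0) at_top"
    unfolding \<eta>_def by real_asymp
  hence "eventually (\<lambda>K. \<eta> K < 1) at_top"
    by (rule order_tendstoD) simp
  moreover have "eventually (\<lambda>K. max 3 (max x1 (b + 1)) \<le> K) at_top"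
    by (rule eventually_ge_at_top)
  ultimately have "eventually (\<lambda>K. q * (1 + a / K) * exp (\<eta> K) < \<theta> \<and> \<eta> K < 1 \<and> max 3 (max x1 (b + 1)) \<le> K) at_top"
    by eventually_elim simp
  then obtain K where K: "q * (1 + a / K) * exp (\<eta> K) < \<theta>" "\<eta> K < 1" "3 \<le> K" "x1 \<le> K" "b < K"
    unfolding eventually_at_top_linorder by force
  define A where "A = 2 / (1 - \<theta>)"
  have A: "1 \<le> A"
    using \<theta> by (simp add: A_def field_simps)
  define T where "T x = x + a * ln x powr \<alpha>" for x
  define T' where "T' x = 1 + a * (\<alpha> * ln x powr (\<alpha> - 1) / x)" for x
  have ln_ge_1: "1 \<le> ln x" if "3 \<le> x" for x :: real
    using that exp_le by (subst ln_ge_iff) auto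
  have "(\<integral>x. x ^ n \<partial>N) \<le> (A * (2 * K) * (real n * ln (real n))) ^ n" if "n \<ge> 3" for n
  proof -
    define R where "R = K * (real n * ln (real n))"
    have ln_n: "1 \<le> ln (real n)"
      using that by (intro ln_ge_1) simp
    have "1 * 1 \<le> real n * ln (real n)"
      using that ln_n by (intro mult_mono) auto
    hence R: "K \<le> R" "0 < R" "3 \<le> R"
      using K(3) by (auto simp: R_def intro: order_trans)
    have ln_R: "real n * (a * ln R) \<le> \<eta> K * R"
    proof -
      \<comment> \<open>Both \<open>ln (ln n) \<le> ln n\<close> and \<open>ln K \<le> ln K ln n\<close>, since \<open>ln n \<ge> 1\<close>.\<close>
      have "ln R = ln K + ln (real n) + ln (ln (real n))"
        using K(3) that ln_n by (simp add: R_def ln_mult_pos)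
      also have "\<dots> \<le> ln K * ln (real n) + ln (real n) + ln (real n)"
      proof -
        have "ln K * 1 \<le> ln K * ln (real n)"
          using ln_n ln_ge_1 [OF K(3)] by (intro mult_left_mono) auto
        thus ?thesis
          using ln_n ln_le_minus_one [of "ln (real n)"] by linarith
      qed
      also have "\<dots> = (ln K + 2) * ln (real n)"
        by (simp add: algebra_simps)
      finally have "real n * a * ln R \<le> real n * a * ((ln K + 2) * ln (real n))"
        using a by (intro mult_left_mono) auto
      also have "\<dots> = \<eta> K * R"
        using K(3) by (simp add: \<eta>_def R_def)
      finally show ?thesis by (simp add: mult.assoc)
    qed
    have shift: "0 \<le> a * ln x powr \<alpha>" "real n * (a * ln x powr \<alpha>) \<le> \<eta> K * x" if "R \<le> x" for x
    proof -
      have x: "3 \<le> x" "1 \<le> ln x"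
        using that R ln_ge_1 [of x] by auto
      show "0 \<le> a * ln x powr \<alpha>"
        using a by simp
      have "ln x powr \<alpha> \<le> ln x powr 1"
        using x \<alpha> by (intro powr_mono) auto
      hence "real n * (a * ln x powr \<alpha>) \<le> real n * (a * ln x)"
        using x a by (intro mult_left_mono) auto
      also have "\<dots> = real n * a * (ln x / x) * x"
        using x by simp
      also have "\<dots> \<le> real n * a * (ln R / R) * x"
        using ln_x_over_x_mono [of R x] that R exp_le x a
        by (intro mult_right_mono mult_left_mono) auto
      also have "\<dots> \<le> \<eta> K * x"
        using ln_R R x by (intro mult_right_mono) (auto simp: field_simps)
      finally show "real n * (a * ln x powr \<alpha>) \<le> \<eta> K * x" .
    qed
    have "(\<integral>x. x ^ n \<partial>N) \<le> R ^ n + T R ^ n / (1 - \<theta>)"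
    proof (rule moment_le_of_tail_contraction [OF N nonneg ac])
      show "0 \<le> g x" if "x \<ge> b" for x
        using g_pos [OF that] by simp
      show "b < R" "0 < R" "n \<ge> 1" "0 \<le> \<theta>" "\<theta> < 1"
        using K R that \<theta> by auto
      have "x \<noteq> 0 \<and> ln x \<noteq> 0" if "x \<in> {R..}" for x
        using that R ln_ge_1 [of x] by auto
      thus "continuous_on {R..} T'"
        unfolding T'_def by (intro continuous_intros) auto
      fix x assume x: "R \<le> x"
      hence x3: "3 \<le> x" "K \<le> x" "1 \<le> ln x"
        using R ln_ge_1 [of x] by auto
      show "(T has_real_derivative T' x) (at x)"
        unfolding T_def T'_def using x3
        by (auto intro!: derivative_eq_intros simp: field_simps)
      show T'_nonneg: "0 \<le> T' x"
        using x3 a \<alpha> by (simp add: T'_def)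
      show "x \<le> T x"
        using shift [OF x] by (simp add: T_def)
      have "\<alpha> * ln x powr (\<alpha> - 1) \<le> 1 * 1"
        using x3 \<alpha> powr_mono [of "\<alpha> - 1" 0 "ln x"] by (intro mult_mono) auto
      hence "a * (\<alpha> * ln x powr (\<alpha> - 1) / x) \<le> a * (1 / K)"
        using x3 K(3) a by (intro mult_left_mono frac_le) auto
      hence T'_le: "T' x \<le> 1 + a / K"
        by (simp add: T'_def)
      have "T x ^ n = x ^ n * (1 + a * ln x powr \<alpha> / x) ^ n"
        using x3 by (simp add: T_def power_mult_distrib [symmetric] field_simps)
      also have "\<dots> \<le> x ^ n * exp (a * ln x powr \<alpha> / x) ^ n"
        using x3 shift [OF x] by (intro mult_left_mono power_mono exp_ge_add_one_self) auto
      also have "exp (a * ln x powr \<alpha> / x) ^ n \<le> exp (\<eta> K)"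
        using x3 shift [OF x] by (simp add: exp_of_nat_mult [symmetric] field_simps)
      finally have Tn_le: "T x ^ n \<le> x ^ n * exp (\<eta> K)"
        using x3 by simp
      have "b \<le> x" "b \<le> T x"
        using x3 K(5) shift [OF x] by (auto simp: T_def)
      hence pos: "0 < g x" "0 < g (T x)"
        using g_pos by auto
      have "T x ^ n * g (T x) * T' x \<le> (x ^ n * exp (\<eta> K)) * (q * g x) * (1 + a / K)"
        using Tn_le T'_le T'_nonneg decay [of x] pos x3 K q a
        by (intro mult_mono) (auto simp: T_def)
      also have "\<dots> = q * (1 + a / K) * exp (\<eta> K) * (x ^ n * g x)"
        by (simp add: mult_ac)
      also have "\<dots> \<le> \<theta> * (x ^ n * g x)"
        using K(1) pos x3 by (intro mult_right_mono) auto
      finally show "T x ^ n * g (T x) * T' x \<le> \<theta> * (x ^ n * g x)" .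
    qed
    also have "T R ^ n \<le> (2 * R) ^ n"
    proof (rule power_mono)
      have "1 * (a * ln R powr \<alpha>) \<le> real n * (a * ln R powr \<alpha>)"
        using that a by (intro mult_right_mono) auto
      also have "\<dots> \<le> \<eta> K * R"
        by (rule shift) simp
      also have "\<dots> \<le> 1 * R"
        using K(2) R by (intro mult_right_mono) auto
      finally show "T R \<le> 2 * R"
        by (simp add: T_def)
      show "0 \<le> T R"
        using shift [of R] R by (simp add: T_def)
    qed
    also have "R ^ n + (2 * R) ^ n / (1 - \<theta>) \<le> (2 * R) ^ n / (1 - \<theta>) + (2 * R) ^ n / (1 - \<theta>)"
    proof (rule add_right_mono)
      have "R ^ n \<le> (2 * R) ^ n"
        using R by (intro power_mono) auto
      also have "\<dots> \<le> (2 * R) ^ n / (1 - \<theta>)"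
        using R \<theta> by (simp add: field_simps)
      finally show "R ^ n \<le> (2 * R) ^ n / (1 - \<theta>)" .
    qed
    also have "\<dots> = A * (2 * R) ^ n"
      by (simp add: A_def)
    also have "\<dots> \<le> A ^ n * (2 * R) ^ n"
      using A R that self_le_power [of A n] by (intro mult_right_mono) auto
    also have "\<dots> = (A * (2 * K) * (real n * ln (real n))) ^ n"
      by (simp add: R_def power_mult_distrib [symmetric] mult_ac)
    finally show ?thesis
      using \<theta> by (simp add: divide_right_mono)
  qed
  moreover have "1 \<le> A * (2 * K)"
    using A K(3) mult_mono [of 1 A 1 "2 * K"] by simp
  ultimately show ?thesis
    by blast
qed

section \<open>Carleman's condition from moment growth\<close>

lemma ln_ln_increment_le:
  fixes x :: real
  assumes "1 < x"
  shows "ln (ln (x + 1)) - ln (ln x) \<le> 1 / (x * ln x)"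
proof -
  have pos: "0 < ln x" "0 < 1 + 1 / (x * ln x)"
    using assms by (auto intro!: add_pos_pos divide_pos_pos mult_pos_pos)
  have "ln (x + 1) - ln x = ln (1 + 1 / x)"
    using assms ln_div [of "x + 1" x] by (simp add: add_divide_distrib)
  also have "\<dots> \<le> 1 / x"
    using assms by (intro ln_add_one_self_le_self) auto
  also have "1 / x = ln x * (1 + 1 / (x * ln x)) - ln x"
    using assms pos by (simp add: field_simps)
  finally have "ln (ln (x + 1)) \<le> ln (ln x * (1 + 1 / (x * ln x)))"
    using assms by (intro ln_mono) auto
  also have "\<dots> = ln (ln x) + ln (1 + 1 / (x * ln x))"
    using pos by (rule ln_mult_pos)
  also have "ln (1 + 1 / (x * ln x)) \<le> 1 / (x * ln x)"
    using assms pos by (intro ln_add_one_self_le_self) auto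
  finally show ?thesis
    by simp
qed

text \<open>
  The partial sums dominate the telescoping sums of the increments of \<open>ln (ln x)\<close>.
\<close>
lemma not_summable_inverse_n_ln_n:
  "\<not> summable (\<lambda>n. 1 / (real (n + 2) * ln (real (n + 2))))"
proof
  let ?u = "\<lambda>n. 1 / (real (n + 2) * ln (real (n + 2)))"
  assume sum: "summable ?u"
  have tele: "ln (ln (real (n + 2))) - ln (ln 2) \<le> (\<Sum>k<n. ?u k)" for n
  proof (induction n)
    case (Suc n)
    have "real (Suc n + 2) = real (n + 2) + 1"
      by simp
    with Suc ln_ln_increment_le [of "real (n + 2)"] show ?case
      by (simp only: sum.lessThan_Suc) linarith
  qed simp
  have "filterlim (\<lambda>n. ln (ln (real (n + 2))) - ln (ln 2)) at_top at_top"
    by real_asymp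
  hence "filterlim (\<lambda>n. \<Sum>k<n. ?u k) at_top sequentially"
    by (rule filterlim_at_top_mono) (use tele in auto)
  moreover have "(\<lambda>n. \<Sum>k<n. ?u k) \<longlonglongrightarrow> suminf ?u"
    using sum by (rule summable_LIMSEQ)
  ultimately show False
    using not_tendsto_and_filterlim_at_infinity [OF sequentially_bot]
    by (blast intro: filterlim_at_top_imp_at_infinity)
qed

text \<open>
  The bound has the form of the growth estimate for \<open>Y\<close> in order \<open>2 n\<close>, which is the moment of
  \<open>Y\<^sup>2\<close> in order \<open>n\<close>.  Each term of Carleman's series is then at least a constant multiple of
  \<open>1 / (n ln n)\<close>, in the extended sense also where a moment vanishes.
\<close>
lemma carleman_S_of_growth:
  assumes W: "nonneg_with_finite_moments M W" and C: "1 \<le> C"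
    and growth: "\<And>n. n \<ge> 3 \<Longrightarrow> (\<integral>\<omega>. W \<omega> ^ n \<partial>M) \<le> (C * (real (2 * n) * ln (real (2 * n)))) ^ (2 * n)"
  shows "carleman_S M W"
proof -
  define c where "c n = inverse (ennreal ((\<integral>\<omega>. W \<omega> ^ Suc n \<partial>M) powr (1 / (2 * real (Suc n)))))" for n
  define f where "f n = (if n < 2 then 0 else 1 / (4 * C) * (1 / (real (Suc n) * ln (real (Suc n)))))" for n
  have f_nonneg: "0 \<le> f n" for n
    using C by (auto simp: f_def)
  have f_le: "ennreal (f k) \<le> c k" for k
  proof (cases "k < 2")
    case False
    define n where "n = Suc k"
    have n: "n \<ge> 3"
      using False by (simp add: n_def)
    have m_nonneg: "0 \<le> (\<integral>\<omega>. W \<omega> ^ n \<partial>M)"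
      using W by (intro integral_nonneg_AE) (auto simp: nonneg_with_finite_moments_def)
    have ln_n: "0 < ln (real n)"
      using n by simp
    define u where "u = C * (real (2 * n) * ln (real (2 * n)))"
    have u: "0 < u"
      using C n unfolding u_def by (intro mult_pos_pos) auto
    have "(\<integral>\<omega>. W \<omega> ^ n \<partial>M) powr (1 / (2 * real n)) \<le> (u ^ (2 * n)) powr (1 / (2 * real n))"
      using growth [OF n] m_nonneg n by (intro powr_mono2) (auto simp: u_def)
    also have "\<dots> = u"
      using n u by (simp add: powr_realpow [symmetric] powr_powr del: powr_realpow)
    also have "u \<le> 4 * C * (real n * ln (real n))"
    proof -
      have "ln (real (2 * n)) \<le> 2 * ln (real n)"
        using n ln_mono [of 2 "real n"] by (simp add: ln_mult_pos)
      hence "C * real (2 * n) * ln (real (2 * n)) \<le> C * real (2 * n) * (2 * ln (real n))"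
        using C by (intro mult_left_mono) auto
      thus ?thesis by (simp add: u_def)
    qed
    finally have le: "(\<integral>\<omega>. W \<omega> ^ n \<partial>M) powr (1 / (2 * real n)) \<le> 4 * C * (real n * ln (real n))" .
    have "0 < 4 * C * (real n * ln (real n))"
      using C n ln_n by (intro mult_pos_pos) auto
    hence "ennreal (f k) = inverse (ennreal (4 * C * (real n * ln (real n))))"
      using False by (simp add: inverse_ennreal inverse_eq_divide f_def n_def)
    also have "\<dots> \<le> c k"
    proof (cases "(\<integral>\<omega>. W \<omega> ^ n \<partial>M) powr (1 / (2 * real n)) = 0")
      case True
      thus ?thesis by (simp only: c_def n_def [symmetric]) simp
    next
      case False
      hence pos: "0 < (\<integral>\<omega>. W \<omega> ^ n \<partial>M) powr (1 / (2 * real n))"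
        by (simp only: powr_gt_zero powr_eq_0_iff not_False_eq_True)
      show ?thesis
        unfolding c_def n_def [symmetric] inverse_ennreal [OF pos] inverse_ennreal [OF less_le_trans [OF pos le]]
        by (rule ennreal_leI [OF le_imp_inverse_le [OF le pos]])
    qed
    finally show ?thesis .
  qed (simp add: f_def)
  have "(\<Sum>n. c n) = \<infinity>"
  proof (rule ccontr)
    assume "(\<Sum>n. c n) \<noteq> \<infinity>"
    moreover have "(\<Sum>n. ennreal (f n)) \<le> (\<Sum>n. c n)"
      by (intro suminf_le f_le) auto
    ultimately have "summable f"
      by (intro summable_suminf_not_top f_nonneg) (auto simp: top_unique)
    hence "summable (\<lambda>n. f (n + 2))"
      by (rule summable_iff_shift [THEN iffD2])
    hence "summable (\<lambda>n. 4 * C * f (n + 2))"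
      by (rule summable_mult)
    moreover have "4 * C * f (n + 2) = 1 / (real (n + 1 + 2) * ln (real (n + 1 + 2)))" for n
      using C by (simp add: f_def add_ac)
    ultimately have "summable (\<lambda>n. 1 / (real (n + 1 + 2) * ln (real (n + 1 + 2))))"
      by (simp only:)
    hence "summable (\<lambda>n. 1 / (real (n + 2) * ln (real (n + 2))))"
      by (rule summable_iff_shift [THEN iffD1])
    with not_summable_inverse_n_ln_n show False by contradiction
  qed
  with W show ?thesis
    by (simp add: carleman_S_def c_def)
qed

section \<open>The decay criterion\<close>

theorem corollary3:
  fixes M :: "'a measure" and Y :: "'a \<Rightarrow> real" and G g :: "real \<Rightarrow> real"
    and x0 a \<alpha> :: real
  assumes "prob_space M"
    and "nonneg_with_finite_moments M Y"
    and "G = cdf (distr M borel Y)"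
    and "x0 > 1"
    and "absolutely_continuous_with_density_from G x0 g"
    and "\<And>x. x \<ge> x0 \<Longrightarrow> g x > 0"
    and "a > 0"
    and "0 \<le> \<alpha>" "\<alpha> \<le> 1"
    and "Limsup at_top (\<lambda>x. ereal (g (x + a * (ln x) powr \<alpha>) / g x)) < 1"
  shows "carleman_S M Y \<and> carleman_S M (\<lambda>\<omega>. (Y \<omega>)\<^sup>2) \<and>
         M_det_nonneg M Y \<and> M_det_nonneg M (\<lambda>\<omega>. (Y \<omega>)\<^sup>2)"
proof -
  interpret prob_space M by fact
  have Y [measurable]: "Y \<in> borel_measurable M" and Y_nonneg: "AE \<omega> in M. 0 \<le> Y \<omega>"
    and int_Y: "\<And>n. n \<ge> 1 \<Longrightarrow> integrable M (\<lambda>\<omega>. Y \<omega> ^ n)"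
    using assms(2) by (auto simp: nonneg_with_finite_moments_def)
  define N where "N = distr M borel Y"
  have N: "real_distribution N"
    unfolding N_def by simp
  have N_nonneg: "nonneg_with_finite_moments N (\<lambda>x. x)"
    using Y_nonneg int_Y by (auto simp: nonneg_with_finite_moments_def N_def AE_distr_iff integrable_distr_eq)
  have N_moments: "(\<integral>x. x ^ n \<partial>N) = (\<integral>\<omega>. Y \<omega> ^ n \<partial>M)" for n
    unfolding N_def by (subst integral_distr) simp_all
  obtain q' where q': "Limsup at_top (\<lambda>x. ereal (g (x + a * (ln x) powr \<alpha>) / g x)) < ereal q'" "ereal q' < 1"
    using ereal_dense2 [OF assms(10)] by auto
  \<comment> \<open>The maximum makes the contraction factor positive.\<close>
  define q where "q = max q' (1/2)"
  have q: "0 < q" "q < 1"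
    using q'(2) by (auto simp: q_def)
  have "eventually (\<lambda>x. ereal (g (x + a * (ln x) powr \<alpha>) / g x) < ereal q') at_top"
    using q'(1) by (rule Limsup_lessD)
  hence "eventually (\<lambda>x. g (x + a * (ln x) powr \<alpha>) \<le> q * g x) at_top"
    using eventually_ge_at_top [of x0]
  proof eventually_elim
    case (elim x)
    hence "0 < g x" "g (x + a * (ln x) powr \<alpha>) / g x \<le> q"
      using assms(6) [of x] by (auto simp: q_def)
    thus ?case by (simp add: field_simps)
  qed
  then obtain x1 where x1: "\<And>x. x \<ge> x1 \<Longrightarrow> g (x + a * ln x powr \<alpha>) \<le> q * g x"
    unfolding eventually_at_top_linorder by blast
  have "absolutely_continuous_with_density_from (cdf N) x0 g"
    using assms(3,5) by (simp add: N_def)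
  hence "\<exists>C\<ge>1. \<forall>n\<ge>3. (\<integral>x. x ^ n \<partial>N) \<le> (C * (real n * ln (real n))) ^ n"
    by (rule moment_growth [where g = g and a = a and \<alpha> = \<alpha>, OF N N_nonneg _ assms(6-9) q x1])
  then obtain C where C: "1 \<le> C"
    and growth: "\<And>n. n \<ge> 3 \<Longrightarrow> (\<integral>\<omega>. Y \<omega> ^ n \<partial>M) \<le> (C * (real n * ln (real n))) ^ n"
    by (auto simp: N_moments)
  have "carleman_S M Y"
  proof (rule carleman_S_of_growth [OF assms(2) C])
    fix n :: nat assume n: "n \<ge> 3"
    \<comment> \<open>For \<open>Y\<close> itself the estimate in order \<open>n\<close> is far below the one required: its base is at least
        \<open>1\<close> and may be raised to the power \<open>2 n\<close>.\<close>
    define u where "u k = C * (real k * ln (real k))" for k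
    have "1 \<le> ln (real n)"
      using n exp_le by (subst ln_ge_iff) auto
    hence "1 * (1 * 1) \<le> u n"
      unfolding u_def using n C by (intro mult_mono) auto
    moreover have "u n \<le> u (2 * n)"
      unfolding u_def using n C by (intro mult_left_mono mult_mono) auto
    ultimately have "u n ^ n \<le> u (2 * n) ^ n" "u (2 * n) ^ n \<le> u (2 * n) ^ (2 * n)"
      by (auto intro!: power_mono power_increasing)
    with growth [OF n] show "(\<integral>\<omega>. Y \<omega> ^ n \<partial>M) \<le> (C * (real (2 * n) * ln (real (2 * n)))) ^ (2 * n)"
      unfolding u_def by linarith
  qed
  moreover have "carleman_S M (\<lambda>\<omega>. (Y \<omega>)\<^sup>2)"
  proof (rule carleman_S_of_growth [OF _ C])
    show "nonneg_with_finite_moments M (\<lambda>\<omega>. (Y \<omega>)\<^sup>2)"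
      using int_Y by (auto simp: nonneg_with_finite_moments_def power_mult [symmetric])
    show "(\<integral>\<omega>. ((Y \<omega>)\<^sup>2) ^ n \<partial>M) \<le> (C * (real (2 * n) * ln (real (2 * n)))) ^ (2 * n)" if "n \<ge> 3" for n
      using growth [of "2 * n"] that by (simp add: power_mult [symmetric])
  qed
  ultimately show ?thesis
    using carleman_S_imp_M_det [OF \<open>prob_space M\<close>] by blast
qed

end
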